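(* Let $M_P=(\Sigma,A,\tau,\rho_\alpha)$ be the CVaR-cost particle belief MDP with risk level $\alpha\in(0,1]$, discount $\gamma\in(0,1]$ and horizon $T\in\mathbb N$, let $\pi$ be a policy, and let $\hat Q^\pi_{M_P,t}$ be the Monte Carlo policy-evaluation estimator with $N_b\in\mathbb N$ sampled successor beliefs per node (all defined in the context). Let $\Delta\rho=c_{\max}-c_{\min}$ and $S_t=\frac{(T-t)(T-t+1)}{2}$. Then for every $t\in\{0,\dots,T\}$, every particle belief $\bar b_t\in\Sigma$, every action $a\in A$, every $\delta\in(0,1)$ and every integer $N_b>1$, $$P\left(\left|Q^\pi_{M_P,t}(\bar b_t,a,\alpha)-\hat Q^\pi_{M_P,t}(\bar b_t,a,\alpha)\right|\le \Delta\rho\cdot S_t\sqrt{\frac{\ln\left(\frac{2(N_b^{T-t}-1)}{\delta(N_b-1)}\right)}{2N_b}}\right)\ge 1-\delta,$$ where the right-hand side of the inequality inside the probability is read as $0$ when $t=T$.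
   Context: Costs. $X$ is a state space, $A$ an action space, and $c:X\times A\to\mathbb R$ a cost with $c_{\min}\le c(x,a)\le c_{\max}$ for all $x,a$. Weighted CVaR. For reals $y_1,\dots,y_n$ and weights $\tilde w_i\ge 0$ with $\sum_i\tilde w_i=1$, $\hat C_\alpha(\{y_i\},\{\tilde w_i\})=\inf_{w\in\mathbb R}\{w+\frac1\alpha\sum_{i=1}^n\tilde w_i(y_i-w)^+\}$, with $(y)^+=\max(y,0)$. Particle belief MDP (PB-MDP). Fix $N_p\in\mathbb N$. Its states are particle beliefs $\Sigma=\{\bar b=\{(x_i,w_i)\}_{i=1}^{N_p}: x_i\in X,\ w_i\ge0,\ \sum_i w_i>0\}$; its actions are $A$; $\tau(\bar b_{t+1}\mid\bar b_t,a)$ is its (Markov) transition kernel on $\Sigma$; its immediate cost is $\rho_\alpha(\bar b,a)=\hat C_\alpha(\{c(x_i,a)\}_{i=1}^{N_p},\{\tilde w_i\}_{i=1}^{N_p})$ with $\tilde w_i=w_i/\sum_j w_j$. Value functions. For a policy $\pi$ (choosing an action as a function of the particle belief, possibly time-dependent), $V^\pi_{M_P,T+1}=0$ and, for $t\le T$, $Q^\pi_{M_P,t}(\bar b_t,a,\alpha)=\rho_\alpha(\bar b_t,a)+\gamma\,\mathbb E[V^\pi_{M_P,t+1}(\bar b_{t+1},\alpha)\mid\bar b_t,a]$ with $\bar b_{t+1}\sim\tau(\cdot\mid\bar b_t,a)$, and $V^\pi_{M_P,t}(\bar b_t,\alpha)=Q^\pi_{M_P,t}(\bar b_t,\pi(\bar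 b_t),\alpha)$. Estimator. $\hat V^\pi_{M_P,T+1}=0$ and, for $t\le T$, $\hat Q^\pi_{M_P,t}(\bar b_t,a,\alpha)=\rho_\alpha(\bar b_t,a)+\frac{\gamma}{N_b}\sum_{i=1}^{N_b}\hat V^\pi_{M_P,t+1}(\bar b^i_{t+1},\alpha)$, $\hat V^\pi_{M_P,t}(\bar b_t,\alpha)=\hat Q^\pi_{M_P,t}(\bar b_t,\pi(\bar b_t),\alpha)$, where $\bar b^1_{t+1},\dots,\bar b^{N_b}_{t+1}$ are i.i.d. samples from $\tau(\cdot\mid\bar b_t,a)$, and the estimators at the sampled successors are built recursively in the same way with fresh independent samples. The probability is over this sampling. *)

theory Defs
  imports "HOL-Probability.Probability"
begin

definition weighted_cvar ::
    "real \<Rightarrow> nat \<Rightarrow> (nat \<Rightarrow> real) \<Rightarrow> (nat \<Rightarrow> real) \<Rightarrow> real" where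
  "weighted_cvar \<alpha> n y w =
     (INF v. v + 1 / \<alpha> * (\<Sum>i = 1..n. w i * max (y i - v) 0))"

text \<open>
  A particle belief is a family of pairs (particle, weight) indexed by \<open>{1..Np}\<close>
  (extensional, i.e. \<open>undefined\<close> outside this index set).  Weights are not normalised.
\<close>

type_synonym 'x belief = "nat \<Rightarrow> 'x \<times> real"

definition belief_space :: "'x measure \<Rightarrow> nat \<Rightarrow> 'x belief measure" where
  "belief_space X Np =
     restrict_space (\<Pi>\<^sub>M i\<in>{1..Np}. X \<Otimes>\<^sub>M borel)
       {b. (\<forall>i\<in>{1..Np}. 0 \<le> snd (b i)) \<and> 0 < (\<Sum>i = 1..Np. snd (b i))}"

definition norm_weight :: "nat \<Rightarrow> 'x belief \<Rightarrow> nat \<Rightarrow> real" where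
  "norm_weight Np b i = snd (b i) / (\<Sum>j = 1..Np. snd (b j))"

definition cvar_cost ::
    "('x \<Rightarrow> 'a \<Rightarrow> real) \<Rightarrow> nat \<Rightarrow> real \<Rightarrow> 'x belief \<Rightarrow> 'a \<Rightarrow> real" where
  "cvar_cost c Np \<alpha> b a =
     weighted_cvar \<alpha> Np (\<lambda>i. c (fst (b i)) a) (norm_weight Np b)"

text \<open>
  Value functions of a finite-horizon MDP with states \<open>'s\<close>, immediate cost \<open>\<rho>\<close>,
  transition kernel \<open>\<tau>\<close>, discount \<open>\<gamma>\<close>, horizon \<open>T\<close> and time-dependent policy \<open>\<pi>\<close>.
\<close>

function V_val :: "('s \<Rightarrow> 'a \<Rightarrow> real) \<Rightarrow> ('s \<Rightarrow> 'a \<Rightarrow> 's measure) \<Rightarrow> real \<Rightarrow> nat \<Rightarrow>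
      (nat \<Rightarrow> 's \<Rightarrow> 'a) \<Rightarrow> nat \<Rightarrow> 's \<Rightarrow> real"
  and Q_val :: "('s \<Rightarrow> 'a \<Rightarrow> real) \<Rightarrow> ('s \<Rightarrow> 'a \<Rightarrow> 's measure) \<Rightarrow> real \<Rightarrow> nat \<Rightarrow>
      (nat \<Rightarrow> 's \<Rightarrow> 'a) \<Rightarrow> nat \<Rightarrow> 's \<Rightarrow> 'a \<Rightarrow> real" where
  "V_val \<rho> \<tau> \<gamma> T \<pi> t b = (if t > T then 0 else Q_val \<rho> \<tau> \<gamma> T \<pi> t b (\<pi> t b))"
| "Q_val \<rho> \<tau> \<gamma> T \<pi> t b a =
     \<rho> b a + \<gamma> * (\<integral>b'. V_val \<rho> \<tau> \<gamma> T \<pi> (Suc t) b' \<partial>(\<tau> b a))"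
  by pat_completeness auto
termination
  by (relation "Wellfounded.measure (\<lambda>z. case z of
        Inl (_, _, _, T, _, t, _) \<Rightarrow> 2 * (Suc T - t)
      | Inr (_, _, _, T, _, t, _, _) \<Rightarrow> (if t > T then 1 else 2 * (Suc T - t) - 1))") auto

declare V_val.simps [simp del] Q_val.simps [simp del]

text \<open>
  The Monte Carlo estimators, given as sampling programs in the Giry monad:
  \<open>Q_est\<close> and \<open>V_est\<close> are the laws of the random estimates.  The successors
  \<open>bs 1, \<dots>, bs Nb\<close> are i.i.d. from \<open>\<tau> b a\<close>; given these, the estimates
  \<open>vs 1, \<dots>, vs Nb\<close> at the successors use fresh randomness, so their joint law is the
  product of the laws of the recursively built estimators.
\<close>

function V_est :: "('s \<Rightarrow> 'a \<Rightarrow> real) \<Rightarrow> ('s \<Rightarrow> 'a \<Rightarrow> 's measure) \<Rightarrow> real \<Rightarrow> nat \<Rightarrow> nat \<Rightarrow>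
      (nat \<Rightarrow> 's \<Rightarrow> 'a) \<Rightarrow> nat \<Rightarrow> 's \<Rightarrow> real measure"
  and Q_est :: "('s \<Rightarrow> 'a \<Rightarrow> real) \<Rightarrow> ('s \<Rightarrow> 'a \<Rightarrow> 's measure) \<Rightarrow> real \<Rightarrow> nat \<Rightarrow> nat \<Rightarrow>
      (nat \<Rightarrow> 's \<Rightarrow> 'a) \<Rightarrow> nat \<Rightarrow> 's \<Rightarrow> 'a \<Rightarrow> real measure" where
  "V_est \<rho> \<tau> \<gamma> T Nb \<pi> t b =
     (if t > T then return borel 0 else Q_est \<rho> \<tau> \<gamma> T Nb \<pi> t b (\<pi> t b))"
| "Q_est \<rho> \<tau> \<gamma> T Nb \<pi> t b a =
     do {
       bs \<leftarrow> (\<Pi>\<^sub>M i\<in>{1..Nb}. \<tau> b a);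
       vs \<leftarrow> (\<Pi>\<^sub>M i\<in>{1..Nb}. V_est \<rho> \<tau> \<gamma> T Nb \<pi> (Suc t) (bs i));
       return borel (\<rho> b a + \<gamma> / real Nb * (\<Sum>i = 1..Nb. vs i))
     }"
  by pat_completeness auto
termination
  by (relation "Wellfounded.measure (\<lambda>z. case z of
        Inl (_, _, _, T, _, _, t, _) \<Rightarrow> 2 * (Suc T - t)
      | Inr (_, _, _, T, _, _, t, _, _) \<Rightarrow> (if t > T then 1 else 2 * (Suc T - t) - 1))") auto

declare V_est.simps [simp del] Q_est.simps [simp del]

end

theory Submission
  imports Defs
begin

text \<open>
  The cost \<open>cvar_cost\<close> takes values in \<open>[c_min, c_max]\<close>, so the value function at time \<open>s + 1\<close>
  ranges over an interval of length at most \<open>(T - s) * (c_max - c_min)\<close>.  At each node at time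
  \<open>s < T\<close> of the sampling tree, Hoeffding's inequality bounds the deviation of the average of the true
  successor values from its expectation by \<open>(T - s) * (c_max - c_min) * \<epsilon>\<close>, with failure probability at most
  \<open>2 * exp (- 2 * Nb * \<epsilon>\<^sup>2)\<close>.  Outside the union of these failure events the errors add up along the
  levels to \<open>S_t\<close> times \<open>(c_max - c_min) * \<epsilon>\<close>.  There are
  \<open>(Nb ^ (T - t) - 1) / (Nb - 1)\<close> such nodes, and \<open>\<epsilon>\<close> is chosen to make the union bound equal to \<open>\<delta>\<close>.
\<close>

section \<open>Products of probability kernels and Hoeffding's inequality on a product space\<close>

text \<open>The sampling program draws from product laws whose factors depend on the current node or
  on the sampled successors, so its binds make sense only if such products are again measurable
  kernels. It suffices to test this on boxes, which generate the product sigma-algebra and are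
  stable under intersection; there the measure is a finite product of measurable functions.\<close>

lemma measurable_PiM_prob_algebra:
  assumes I: "finite I"
    and f: "\<And>i. i \<in> I \<Longrightarrow> f i \<in> N \<rightarrow>\<^sub>M prob_algebra (M i)"
  shows "(\<lambda>x. PiM I (\<lambda>i. f i x)) \<in> N \<rightarrow>\<^sub>M prob_algebra (PiM I M)"
proof (rule measurable_prob_algebra_generated[OF sets_PiM Int_stable_prod_algebra
      prod_algebra_sets_into_space])
  have fx: "sets (f i x) = sets (M i)" "prob_space (f i x)" if "i \<in> I" "x \<in> space N" for i x
    using measurable_space[OF f[OF that(1)] that(2)] by (auto simp: space_prob_algebra)
  show "prob_space (PiM I (\<lambda>i. f i x))" if "x \<in> space N" for x
    using that by (intro prob_space_PiM fx)
  show "sets (PiM I (\<lambda>i. f i x)) = sets (PiM I M)" if "x \<in> space N" for x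
    using that by (intro sets_PiM_cong fx refl)
  fix B assume "B \<in> prod_algebra I M"
  then obtain E where B: "B = (\<Pi>\<^sub>E i\<in>I. E i)" and E: "\<And>i. i \<in> I \<Longrightarrow> E i \<in> sets (M i)"
    unfolding prod_algebra_eq_finite[OF I] by blast
  have eq: "emeasure (PiM I (\<lambda>i. f i x)) B = (\<Prod>i\<in>I. emeasure (f i x) (E i))"
    if x: "x \<in> space N" for x
  proof -
    have "emeasure (PiM I (\<lambda>i. f i x)) (prod_emb I (\<lambda>i. f i x) I (\<Pi>\<^sub>E i\<in>I. E i)) =
        (\<Prod>i\<in>I. emeasure (f i x) (E i))"
      using x I E by (intro emeasure_PiM_emb) (auto simp: fx)
    also have "prod_emb I (\<lambda>i. f i x) I (\<Pi>\<^sub>E i\<in>I. E i) = B"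
      unfolding B using x E fx(1) by (intro prod_emb_PiE_same_index) (metis sets.sets_into_space)
    finally show ?thesis .
  qed
  have "(\<lambda>x. \<Prod>i\<in>I. emeasure (f i x) (E i)) \<in> borel_measurable N"
    by (intro borel_measurable_prod_ennreal measurable_compose[OF measurable_prob_algebraD[OF f]
        measurable_emeasure_subprob_algebra] E)
  then show "(\<lambda>x. emeasure (PiM I (\<lambda>i. f i x)) B) \<in> borel_measurable N"
    by (subst measurable_cong[OF eq])
qed

text \<open>The coordinates of a power of \<open>M\<close> are i.i.d. with law \<open>M\<close>, so
  Hoeffding's inequality applies to \<open>f\<close> of the coordinates. Measuring the deviation in
  units of \<open>hi - lo\<close> makes the bound independent of the range. The strict inequality
  keeps the statement true for \<open>lo = hi\<close>, where the event is empty.\<close>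

lemma Hoeffding_iid_PiM:
  fixes f :: "'s \<Rightarrow> real"
  assumes M: "prob_space M" and f [measurable]: "f \<in> borel_measurable M"
    and bd: "\<And>x. x \<in> space M \<Longrightarrow> f x \<in> {lo..hi}"
    and I: "finite I" "I \<noteq> {}" and \<epsilon>: "0 \<le> \<epsilon>"
  shows "measure (PiM I (\<lambda>_. M))
      {x \<in> space (PiM I (\<lambda>_. M)).
        (hi - lo) * \<epsilon> < \<bar>(\<Sum>i\<in>I. f (x i)) / real (card I) - (\<integral>x. f x \<partial>M)\<bar>}
    \<le> 2 * exp (- 2 * real (card I) * \<epsilon>\<^sup>2)"
proof -
  interpret M: prob_space M by fact
  interpret P: prob_space "PiM I (\<lambda>_. M)" by (intro prob_space_PiM M)
  obtain j where j: "j \<in> I" using I by auto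
  have proj: "distr (PiM I (\<lambda>_. M)) M (\<lambda>x. x i) = M" if "i \<in> I" for i
    using that by (intro distr_PiM_component M)
  have comp: "distr (PiM I (\<lambda>_. M)) borel (\<lambda>x. f (x i)) = distr M borel f" if "i \<in> I" for i
    using that by (subst (2) proj[OF that, symmetric]) (simp add: distr_distr o_def)
  obtain x0 where "x0 \<in> space M" using M.not_empty by blast
  with bd have "lo \<le> hi" by force
  show ?thesis
  \<comment> \<open>The exponent of Hoeffding's bound has \<open>(hi - lo)\<^sup>2\<close> as its
    denominator, so a constant \<open>f\<close> is treated by hand.\<close>
  proof (cases "lo = hi")
    case True
    have fx: "f x = lo" if "x \<in> space M" for x using bd[OF that] True by simp
    have "(\<integral>x. f x \<partial>M) = (\<integral>x. lo \<partial>M)" by (intro Bochner_Integration.integral_cong fx refl)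
    moreover have "(\<Sum>i\<in>I. f (x i)) = real (card I) * lo" if "x \<in> space (PiM I (\<lambda>_. M))" for x
    proof -
      have "(\<Sum>i\<in>I. f (x i)) = (\<Sum>i\<in>I. lo)"
        using that by (intro sum.cong refl fx) (auto simp: space_PiM)
      then show ?thesis by simp
    qed
    ultimately have "{x \<in> space (PiM I (\<lambda>_. M)).
        (hi - lo) * \<epsilon> < \<bar>(\<Sum>i\<in>I. f (x i)) / real (card I) - (\<integral>x. f x \<partial>M)\<bar>} = {}"
      using I True by (auto simp: M.prob_space)
    then show ?thesis by (simp only: measure_empty) simp
  next
    case False
    with \<open>lo \<le> hi\<close> have lt: "lo < hi" by simp
    have fi: "(\<lambda>x. f (x i)) \<in> borel_measurable (PiM I (\<lambda>_. M))" if "i \<in> I" for i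
      by (rule measurable_compose[OF measurable_component_singleton[OF that] f])
    \<comment> \<open>Independence means that the joint law of the coordinates is the product of
      their marginals. The joint map is the identity on the product space, and each marginal is
      \<open>M\<close> by \<open>proj\<close>.\<close>
    have indep: "P.indep_vars (\<lambda>_. M) (\<lambda>i x. x i) I"
    proof (subst P.indep_vars_iff_distr_eq_PiM'[OF I(2)])
      have "distr (PiM I (\<lambda>_. M)) (PiM I (\<lambda>_. M)) (\<lambda>x. \<lambda>i\<in>I. x i) =
          distr (PiM I (\<lambda>_. M)) (PiM I (\<lambda>_. M)) (\<lambda>x. x)"
        by (intro distr_cong) (auto simp: space_PiM PiE_restrict)
      also have "\<dots> = PiM I (\<lambda>i. distr (PiM I (\<lambda>_. M)) M (\<lambda>x. x i))"
        by (simp add: proj distr_id2 cong: PiM_cong)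
      finally show "distr (PiM I (\<lambda>_. M)) (PiM I (\<lambda>_. M)) (\<lambda>x. \<lambda>i\<in>I. x i) =
          PiM I (\<lambda>i. distr (PiM I (\<lambda>_. M)) M (\<lambda>x. x i))" .
    qed auto
    interpret H: Hoeffding_ineq_iid "PiM I (\<lambda>_. M)" I "\<lambda>i x. f (x i)" "\<lambda>x. f (x j)" lo hi
      "P.expectation (\<lambda>x. f (x j))"
    proof unfold_locales
      show "P.indep_vars (\<lambda>_. borel) (\<lambda>i x. f (x i)) I"
        using indep by (rule P.indep_vars_compose2) simp
      show "AE x in PiM I (\<lambda>_. M). f (x j) \<in> {lo..hi}"
        using j by (intro AE_I2 bd) (auto simp: space_PiM)
      show "distr (PiM I (\<lambda>_. M)) borel (\<lambda>x. f (x i)) = distr (PiM I (\<lambda>_. M)) borel (\<lambda>x. f (x j))"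
        if "i \<in> I" for i
        unfolding comp[OF that] comp[OF j] ..
      show "(\<lambda>x. f (x j)) \<in> borel_measurable (PiM I (\<lambda>_. M))"
        by (rule fi[OF j])
    qed (fact I(1))
    have E: "P.expectation (\<lambda>x. f (x j)) = (\<integral>x. f x \<partial>M)"
      using integral_distr[OF measurable_component_singleton[OF j] f] by (simp add: proj[OF j])
    have "P.prob {x \<in> space (PiM I (\<lambda>_. M)).
        (hi - lo) * \<epsilon> < \<bar>(\<Sum>i\<in>I. f (x i)) / real (card I) - (\<integral>x. f x \<partial>M)\<bar>}
      \<le> P.prob {x \<in> space (PiM I (\<lambda>_. M)).
        (hi - lo) * \<epsilon> \<le> \<bar>(\<Sum>i\<in>I. f (x i)) / real (card I) - P.expectation (\<lambda>x. f (x j))\<bar>}"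
      unfolding E
    proof (rule P.finite_measure_mono)
      have "(\<lambda>x. (\<Sum>i\<in>I. f (x i))) \<in> borel_measurable (PiM I (\<lambda>_. M))"
        by (intro borel_measurable_sum fi)
      then show "{x \<in> space (PiM I (\<lambda>_. M)).
          (hi - lo) * \<epsilon> \<le> \<bar>(\<Sum>i\<in>I. f (x i)) / real (card I) - (\<integral>x. f x \<partial>M)\<bar>} \<in> P.events"
        by measurable
    qed auto
    also have "\<dots> \<le> 2 * exp (- 2 * real (card I) * ((hi - lo) * \<epsilon>)\<^sup>2 / (hi - lo)\<^sup>2)"
      using lt \<epsilon> I by (intro H.Hoeffding_ineq_abs_ge') auto
    also have "\<dots> = 2 * exp (- 2 * real (card I) * \<epsilon>\<^sup>2)"
      using lt by (simp add: power_mult_distrib)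
    finally show ?thesis .
  qed
qed

section \<open>Range and measurability of the CVaR cost\<close>

text \<open>A lower bound of a continuous function on a dense set holds on its closure. This turns
  the uncountable infimum in the CVaR into a countable one, which preserves measurability.\<close>

lemma cINF_Rats:
  fixes f :: "real \<Rightarrow> real"
  assumes cont: "continuous_on UNIV f" and bdd: "bdd_below (range f)"
  shows "(INF x. f x) = (INF x\<in>\<rat>. f x)"
proof (rule antisym)
  have bdd': "bdd_below (f ` \<rat>)" using bdd by (rule bdd_below_mono) auto
  show "(INF x. f x) \<le> (INF x\<in>\<rat>. f x)"
    by (rule cINF_superset_mono[OF _ bdd]) (use Rats_0 in blast)+
  show "(INF x\<in>\<rat>. f x) \<le> (INF x. f x)"
  proof (rule cINF_greatest)
    fix x :: real
    have x: "x \<in> closure \<rat>" unfolding Rats_closure_real by simp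
    have "continuous_on (closure \<rat>) f" using cont unfolding Rats_closure_real .
    then show "(INF x\<in>\<rat>. f x) \<le> f x"
      using x by (rule continuous_ge_on_closure) (rule cINF_lower[OF bdd'])
  qed simp
qed

context
  fixes \<alpha> :: real and n :: nat and y w :: "nat \<Rightarrow> real"
  assumes \<alpha>: "0 < \<alpha>" "\<alpha> \<le> 1"
    and w: "\<And>i. i \<in> {1..n} \<Longrightarrow> 0 \<le> w i" "(\<Sum>i = 1..n. w i) = 1"
begin

text \<open>Since the weights sum to 1, the mean is \<open>v\<close> plus the weighted mean of
  \<open>y i - v\<close>. Passing to positive parts increases it, and so does the factor
  \<open>1 / \<alpha>\<close>, which is at least 1. The bound is uniform in \<open>v\<close>, so it
  yields both boundedness from below and a lower estimate of the CVaR.\<close>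

lemma weighted_cvar_objective_ge_mean:
  "(\<Sum>i = 1..n. w i * y i) \<le> v + 1 / \<alpha> * (\<Sum>i = 1..n. w i * max (y i - v) 0)"
proof -
  have nn: "0 \<le> (\<Sum>i = 1..n. w i * max (y i - v) 0)" by (intro sum_nonneg mult_nonneg_nonneg w) auto
  have "(\<Sum>i = 1..n. w i * y i) = v + (\<Sum>i = 1..n. w i * (y i - v))"
    using w(2) by (simp add: right_diff_distrib sum_subtractf flip: sum_distrib_right)
  also have "\<dots> \<le> v + (\<Sum>i = 1..n. w i * max (y i - v) 0)"
    by (intro add_left_mono sum_mono mult_left_mono w) auto
  also have "\<dots> \<le> v + 1 / \<alpha> * (\<Sum>i = 1..n. w i * max (y i - v) 0)"
    using mult_right_mono[OF _ nn, of 1 "1 / \<alpha>"] \<alpha> by simp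
  finally show ?thesis .
qed

lemma bdd_below_weighted_cvar_objective:
  "bdd_below (range (\<lambda>v. v + 1 / \<alpha> * (\<Sum>i = 1..n. w i * max (y i - v) 0)))"
  by (rule bdd_belowI2) (rule weighted_cvar_objective_ge_mean)

lemma weighted_cvar_Rats:
  "weighted_cvar \<alpha> n y w = (INF v\<in>\<rat>. v + 1 / \<alpha> * (\<Sum>i = 1..n. w i * max (y i - v) 0))"
  unfolding weighted_cvar_def
  by (intro cINF_Rats bdd_below_weighted_cvar_objective continuous_intros)

text \<open>From below, the CVaR dominates the weighted mean. From above, evaluate the objective at
  \<open>v = hi\<close>, where all positive parts vanish.\<close>

lemma weighted_cvar_bounds:
  assumes y: "\<And>i. i \<in> {1..n} \<Longrightarrow> y i \<in> {lo..hi}"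
  shows "weighted_cvar \<alpha> n y w \<in> {lo..hi}"
proof -
  have "lo = (\<Sum>i = 1..n. w i * lo)" using w(2) by (simp flip: sum_distrib_right)
  also have "\<dots> \<le> (\<Sum>i = 1..n. w i * y i)" using y w by (intro sum_mono mult_left_mono) auto
  finally have "lo \<le> weighted_cvar \<alpha> n y w"
    unfolding weighted_cvar_def
    by (intro cINF_greatest order_trans[OF _ weighted_cvar_objective_ge_mean]) auto
  moreover have "weighted_cvar \<alpha> n y w \<le> hi + 1 / \<alpha> * (\<Sum>i = 1..n. w i * max (y i - hi) 0)"
    unfolding weighted_cvar_def by (intro cINF_lower bdd_below_weighted_cvar_objective) simp
  moreover have "(\<Sum>i = 1..n. w i * max (y i - hi) 0) = 0"
    using y by (intro sum.neutral) (auto simp: max_def)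
  ultimately show ?thesis by simp
qed

end

lemma space_belief_space:
  "b \<in> space (belief_space X Np) \<longleftrightarrow>
    b \<in> (\<Pi>\<^sub>E i\<in>{1..Np}. space X \<times> UNIV) \<and> (\<forall>i\<in>{1..Np}. 0 \<le> snd (b i)) \<and>
    0 < (\<Sum>i = 1..Np. snd (b i))"
  by (auto simp: belief_space_def space_restrict_space space_PiM space_pair_measure)

lemma norm_weight_belief_space:
  assumes "b \<in> space (belief_space X Np)"
  shows "i \<in> {1..Np} \<Longrightarrow> 0 \<le> norm_weight Np b i" "(\<Sum>i = 1..Np. norm_weight Np b i) = 1"
  using assms unfolding space_belief_space norm_weight_def
  by (auto simp flip: sum_divide_distrib)

lemma measurable_belief_component [measurable]:
  "i \<in> {1..Np} \<Longrightarrow> (\<lambda>b. b i) \<in> belief_space X Np \<rightarrow>\<^sub>M X \<Otimes>\<^sub>M borel"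
  unfolding belief_space_def by (intro measurable_restrict_space1) simp

lemma cvar_cost_bounds:
  assumes "0 < \<alpha>" "\<alpha> \<le> 1" and b: "b \<in> space (belief_space X Np)"
    and c: "\<And>x. x \<in> space X \<Longrightarrow> c x a \<in> {lo..hi}"
  shows "cvar_cost c Np \<alpha> b a \<in> {lo..hi}"
  unfolding cvar_cost_def
  using assms(1,2) norm_weight_belief_space[OF b]
proof (rule weighted_cvar_bounds)
  show "c (fst (b i)) a \<in> {lo..hi}" if "i \<in> {1..Np}" for i
    using b that by (intro c) (auto simp: space_belief_space PiE_iff mem_Times_iff)
qed

lemma measurable_cvar_cost:
  assumes \<alpha>: "0 < \<alpha>" "\<alpha> \<le> 1"
    and c: "(\<lambda>(x, a). c x a) \<in> borel_measurable (X \<Otimes>\<^sub>M A)"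
  shows "(\<lambda>(b, a). cvar_cost c Np \<alpha> b a) \<in> borel_measurable (belief_space X Np \<Otimes>\<^sub>M A)"
proof -
  \<comment> \<open>The rational form is available on the space of the product measure, where the
    normalised weights are nonnegative and sum to 1.\<close>
  have eq: "(case z of (b, a) \<Rightarrow> cvar_cost c Np \<alpha> b a) =
      (INF v\<in>\<rat>. v + 1 / \<alpha> * (\<Sum>i = 1..Np. norm_weight Np (fst z) i *
        max (c (fst (fst z i)) (snd z) - v) 0))"
    if "z \<in> space (belief_space X Np \<Otimes>\<^sub>M A)" for z
    unfolding split_beta cvar_cost_def using that
    by (intro weighted_cvar_Rats \<alpha> norm_weight_belief_space[where X = X])
      (auto simp: space_pair_measure)
  have comp: "(\<lambda>z. fst z i) \<in> belief_space X Np \<Otimes>\<^sub>M A \<rightarrow>\<^sub>M X \<Otimes>\<^sub>M borel" if "i \<in> {1..Np}" for i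
    by (rule measurable_compose[OF measurable_fst measurable_belief_component[OF that]])
  have [measurable]: "(\<lambda>z. c (fst (fst z i)) (snd z)) \<in> borel_measurable (belief_space X Np \<Otimes>\<^sub>M A)"
    if "i \<in> {1..Np}" for i
    using measurable_compose[OF measurable_Pair[OF measurable_compose[OF comp[OF that] measurable_fst]
          measurable_snd] c]
    by simp
  have [measurable]: "(\<lambda>z. snd (fst z i)) \<in> borel_measurable (belief_space X Np \<Otimes>\<^sub>M A)"
    if "i \<in> {1..Np}" for i
    by (rule measurable_compose[OF comp[OF that] measurable_snd])
  have "(\<lambda>z. INF v\<in>\<rat>. v + 1 / \<alpha> * (\<Sum>i = 1..Np. norm_weight Np (fst z) i *
        max (c (fst (fst z i)) (snd z) - v) 0)) \<in> borel_measurable (belief_space X Np \<Otimes>\<^sub>M A)"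
    unfolding norm_weight_def by (intro borel_measurable_cINF_real countable_rat) measurable
  then show ?thesis by (subst measurable_cong[OF eq])
qed


section \<open>Finite-horizon MDPs with bounded cost: value functions and their ranges\<close>

text \<open>Particle beliefs enter the concentration argument only through the measurability and the
  range of the cost, so the argument is carried out over an arbitrary state space
  \<open>S\<close>.\<close>

locale bounded_cost_mdp =
  fixes S :: "'s measure" and A :: "'a measure"
    and \<rho> :: "'s \<Rightarrow> 'a \<Rightarrow> real" and \<tau> :: "'s \<Rightarrow> 'a \<Rightarrow> 's measure"
    and \<gamma> lo hi :: real and T Nb :: nat and \<pi> :: "nat \<Rightarrow> 's \<Rightarrow> 'a"
  assumes cost_measurable: "(\<lambda>(b, a). \<rho> b a) \<in> borel_measurable (S \<Otimes>\<^sub>M A)"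
    and cost_bounds: "\<And>b a. b \<in> space S \<Longrightarrow> a \<in> space A \<Longrightarrow> \<rho> b a \<in> {lo..hi}"
    and kernel_measurable: "(\<lambda>(b, a). \<tau> b a) \<in> S \<Otimes>\<^sub>M A \<rightarrow>\<^sub>M prob_algebra S"
    and policy_measurable: "\<And>s. s \<le> T \<Longrightarrow> \<pi> s \<in> S \<rightarrow>\<^sub>M A"
    and discount: "0 \<le> \<gamma>" "\<gamma> \<le> 1"
    and Nb_pos: "0 < Nb"
begin

abbreviation "V \<equiv> V_val \<rho> \<tau> \<gamma> T \<pi>"
abbreviation "Q \<equiv> Q_val \<rho> \<tau> \<gamma> T \<pi>"
abbreviation "V' \<equiv> V_est \<rho> \<tau> \<gamma> T Nb \<pi>"
abbreviation "Q' \<equiv> Q_est \<rho> \<tau> \<gamma> T Nb \<pi>"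
text \<open>The conditional law of the estimate at a node, given its sampled successors
  \<open>bs\<close>; \<open>Q_est\<close> is the mixture of these laws over i.i.d.
  successors.\<close>

abbreviation "estimate t b a bs \<equiv> (\<Pi>\<^sub>M i\<in>{1..Nb}. V' (Suc t) (bs i)) \<bind>
      (\<lambda>vs. return borel (\<rho> b a + \<gamma> / real Nb * (\<Sum>i = 1..Nb. vs i)))"

text \<open>Total discount weight of the costs incurred from time \<open>t\<close> to
  \<open>T\<close>. Truncated subtraction makes it 0 for \<open>t > T\<close>, in agreement with the
  terminal value.\<close>

definition discount_sum :: "nat \<Rightarrow> real" where
  "discount_sum t = (\<Sum>k < Suc T - t. \<gamma> ^ k)"

lemma discount_sum_step: "t \<le> T \<Longrightarrow> discount_sum t = 1 + \<gamma> * discount_sum (Suc t)"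
  by (simp add: discount_sum_def Suc_diff_le sum.lessThan_Suc_shift sum_distrib_left del: sum.lessThan_Suc)

lemma discount_sum_le: "discount_sum t \<le> real (Suc T - t)"
proof -
  have "discount_sum t \<le> (\<Sum>k < Suc T - t. 1)"
    unfolding discount_sum_def using discount by (intro sum_mono power_le_one)
  then show ?thesis by simp
qed

lemma kernel: "b \<in> space S \<Longrightarrow> a \<in> space A \<Longrightarrow> \<tau> b a \<in> space (prob_algebra S)"
  using measurable_space[OF kernel_measurable, of "(b, a)"] by (simp add: space_pair_measure)

lemma policy_in_space: "t \<le> T \<Longrightarrow> b \<in> space S \<Longrightarrow> \<pi> t b \<in> space A"
  using measurable_space[OF policy_measurable] .

lemma measurable_policy_pair: "t \<le> T \<Longrightarrow> (\<lambda>b. (b, \<pi> t b)) \<in> S \<rightarrow>\<^sub>M S \<Otimes>\<^sub>M A"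
  by (intro measurable_Pair measurable_ident_sets[OF refl] policy_measurable)

text \<open>The mutual recursion is broken by assuming the property of \<open>V\<close> one step
  later. The induction on the number of remaining steps then takes place in the lemma about
  \<open>V\<close>; the same pattern serves for the bounds and for the estimators.\<close>

lemma Q_measurable:
  assumes "V (Suc t) \<in> borel_measurable S"
  shows "(\<lambda>(b, a). Q t b a) \<in> borel_measurable (S \<Otimes>\<^sub>M A)"
proof -
  have "(\<lambda>z. \<integral>b'. V (Suc t) b' \<partial>(case z of (b, a) \<Rightarrow> \<tau> b a)) \<in> borel_measurable (S \<Otimes>\<^sub>M A)"
    by (rule measurable_compose[OF measurable_prob_algebraD[OF kernel_measurable]
          integral_measurable_subprob_algebra[OF assms]])
  with cost_measurable show ?thesis
    unfolding split_beta Q_val.simps by (intro borel_measurable_add borel_measurable_times) auto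
qed

lemma V_measurable: "V t \<in> borel_measurable S"
proof (induction "Suc T - t" arbitrary: t)
  case 0
  then show ?case by (simp add: V_val.simps)
next
  case (Suc n)
  then have t: "t \<le> T" and IH: "V (Suc t) \<in> borel_measurable S" by auto
  have "(\<lambda>b. Q t b (\<pi> t b)) \<in> borel_measurable S"
    using measurable_compose[OF measurable_policy_pair[OF t] Q_measurable[OF IH]] by simp
  then show ?case using t by (subst measurable_cong) (simp_all add: V_val.simps)
qed

lemma Q_bounds:
  assumes V: "\<And>b. b \<in> space S \<Longrightarrow> V (Suc t) b \<in> {discount_sum (Suc t) * lo..discount_sum (Suc t) * hi}"
    and t: "t \<le> T" and b: "b \<in> space S" and a: "a \<in> space A"
  shows "Q t b a \<in> {discount_sum t * lo..discount_sum t * hi}"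
proof -
  from kernel[OF b a] have sets: "sets (\<tau> b a) = sets S" and prob: "prob_space (\<tau> b a)"
    by (auto simp: space_prob_algebra)
  interpret P: prob_space "\<tau> b a" by fact
  have V': "V (Suc t) x \<in> {discount_sum (Suc t) * lo..discount_sum (Suc t) * hi}"
    if "x \<in> space (\<tau> b a)" for x
    using V that sets_eq_imp_space_eq[OF sets] by simp
  \<comment> \<open>The endpoints may have any sign, so both are needed to bound the absolute value.
    This gives integrability, without which the integral could not be compared with the
    endpoints.\<close>
  have "\<bar>V (Suc t) x\<bar> \<le> max \<bar>discount_sum (Suc t) * lo\<bar> \<bar>discount_sum (Suc t) * hi\<bar>"
    if "x \<in> space (\<tau> b a)" for x
    using V'[OF that] by auto
  moreover have "V (Suc t) \<in> borel_measurable (\<tau> b a)"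
    unfolding measurable_cong_sets[OF sets refl] by (rule V_measurable)
  ultimately have "integrable (\<tau> b a) (V (Suc t))"
    by (intro P.integrable_const_bound AE_I2) auto
  then have "(\<integral>x. V (Suc t) x \<partial>\<tau> b a) \<in> {discount_sum (Suc t) * lo..discount_sum (Suc t) * hi}"
    using V' by (auto intro!: P.integral_ge_const P.integral_le_const)
  then have "\<gamma> * (\<integral>x. V (Suc t) x \<partial>\<tau> b a) \<in>
      {\<gamma> * (discount_sum (Suc t) * lo)..\<gamma> * (discount_sum (Suc t) * hi)}"
    using discount by (auto intro!: mult_left_mono)
  then show ?thesis
    using cost_bounds[OF b a] by (simp add: Q_val.simps discount_sum_step[OF t] algebra_simps)
qed

lemma V_bounds: "b \<in> space S \<Longrightarrow> V t b \<in> {discount_sum t * lo..discount_sum t * hi}"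
proof (induction "Suc T - t" arbitrary: t b)
  case 0
  then show ?case by (simp add: V_val.simps discount_sum_def)
next
  case (Suc n)
  then have t: "t \<le> T" by simp
  have "Q t b (\<pi> t b) \<in> {discount_sum t * lo..discount_sum t * hi}"
    using Suc t by (intro Q_bounds policy_in_space) auto
  with t show ?case by (simp add: V_val.simps)
qed

section \<open>The estimators as measurable probability kernels\<close>

text \<open>The outer bind over successors in \<open>Q_est\<close> requires the conditional law to
  be measurable jointly in the node \<open>z\<close> and the successors \<open>bs\<close>.\<close>

lemma estimate_measurable:
  assumes V': "V' (Suc t) \<in> S \<rightarrow>\<^sub>M prob_algebra borel"
  shows "(\<lambda>(z, bs). estimate t (fst z) (snd z) bs)
    \<in> (S \<Otimes>\<^sub>M A) \<Otimes>\<^sub>M (\<Pi>\<^sub>M i\<in>{1..Nb}. S) \<rightarrow>\<^sub>M prob_algebra borel"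
  unfolding split_beta
proof (rule measurable_bind_prob_space2[where N = "\<Pi>\<^sub>M i\<in>{1..Nb}. borel"])
  show "(\<lambda>x. \<Pi>\<^sub>M i\<in>{1..Nb}. V' (Suc t) (snd x i))
      \<in> (S \<Otimes>\<^sub>M A) \<Otimes>\<^sub>M (\<Pi>\<^sub>M i\<in>{1..Nb}. S) \<rightarrow>\<^sub>M prob_algebra (\<Pi>\<^sub>M i\<in>{1..Nb}. borel)"
    by (intro measurable_PiM_prob_algebra measurable_compose[OF _ V']) auto
  have "(\<lambda>x. \<rho> (fst (fst (fst x))) (snd (fst (fst x)))) \<in> borel_measurable
      (((S \<Otimes>\<^sub>M A) \<Otimes>\<^sub>M (\<Pi>\<^sub>M i\<in>{1..Nb}. S)) \<Otimes>\<^sub>M (\<Pi>\<^sub>M i\<in>{1..Nb}. borel :: real measure))"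
    using measurable_compose[OF measurable_compose[OF measurable_fst measurable_fst] cost_measurable]
    by (simp add: split_beta)
  then show "(\<lambda>(x, vs). return borel (\<rho> (fst (fst x)) (snd (fst x)) + \<gamma> / real Nb * (\<Sum>i = 1..Nb. vs i)))
      \<in> ((S \<Otimes>\<^sub>M A) \<Otimes>\<^sub>M (\<Pi>\<^sub>M i\<in>{1..Nb}. S)) \<Otimes>\<^sub>M (\<Pi>\<^sub>M i\<in>{1..Nb}. borel) \<rightarrow>\<^sub>M prob_algebra borel"
    unfolding split_beta
    by (intro measurable_compose[OF _ measurable_return_prob_space] borel_measurable_add
        borel_measurable_times borel_measurable_const borel_measurable_sum
        measurable_compose[OF measurable_snd measurable_component_singleton])
qed

lemma Q_est_measurable:
  assumes V': "V' (Suc t) \<in> S \<rightarrow>\<^sub>M prob_algebra borel"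
  shows "(\<lambda>(b, a). Q' t b a) \<in> S \<Otimes>\<^sub>M A \<rightarrow>\<^sub>M prob_algebra borel"
  unfolding split_beta Q_est.simps
proof (rule measurable_bind_prob_space2[where N = "\<Pi>\<^sub>M i\<in>{1..Nb}. S"])
  show "(\<lambda>x. \<Pi>\<^sub>M i\<in>{1..Nb}. \<tau> (fst x) (snd x)) \<in> S \<Otimes>\<^sub>M A \<rightarrow>\<^sub>M prob_algebra (\<Pi>\<^sub>M i\<in>{1..Nb}. S)"
    using kernel_measurable by (intro measurable_PiM_prob_algebra) (auto simp: split_beta)
qed (rule estimate_measurable[OF V'])

lemma V_est_measurable: "V' t \<in> S \<rightarrow>\<^sub>M prob_algebra borel"
proof (induction "Suc T - t" arbitrary: t)
  case 0
  then show ?case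
    by (subst measurable_cong[where g = "\<lambda>_. return borel 0"])
      (auto simp: V_est.simps space_prob_algebra prob_space_return)
next
  case (Suc n)
  then have t: "t \<le> T" and IH: "V' (Suc t) \<in> S \<rightarrow>\<^sub>M prob_algebra borel" by auto
  have "(\<lambda>b. Q' t b (\<pi> t b)) \<in> S \<rightarrow>\<^sub>M prob_algebra borel"
    using measurable_compose[OF measurable_policy_pair[OF t] Q_est_measurable[OF IH]] by simp
  then show ?case using t by (subst measurable_cong) (simp_all add: V_est.simps)
qed

lemma Q_est_in_prob_algebra:
  "b \<in> space S \<Longrightarrow> a \<in> space A \<Longrightarrow> Q' t b a \<in> space (prob_algebra borel)"
  using measurable_space[OF Q_est_measurable[OF V_est_measurable], of "(b, a)"]
  by (simp add: space_pair_measure)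

lemma V_est_in_prob_algebra: "b \<in> space S \<Longrightarrow> V' t b \<in> space (prob_algebra borel)"
  by (rule measurable_space[OF V_est_measurable])

section \<open>Propagation of errors and failure probabilities through the sampling tree\<close>

text \<open>With the successors fixed, the error splits into the sampling error \<open>h\<close> of
  the true successor values and the average of the errors of the recursive estimates. If each of the
  latter is at most \<open>e\<close>, the total is at most \<open>h + e\<close>; hence a larger
  error forces one of the \<open>Nb\<close> recursive estimates to fail, and a union bound
  applies.\<close>

lemma estimate_deviation:
  assumes b: "b \<in> space S" and a: "a \<in> space A"
    and bs: "bs \<in> space (\<Pi>\<^sub>M i\<in>{1..Nb}. S)"
    and dev: "\<bar>(\<Sum>i = 1..Nb. V (Suc t) (bs i)) / real Nb - (\<integral>x. V (Suc t) x \<partial>\<tau> b a)\<bar> \<le> h"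
    and IH: "\<And>b. b \<in> space S \<Longrightarrow> emeasure (V' (Suc t) b) {v. e < \<bar>V (Suc t) b - v\<bar>} \<le> p"
  shows "emeasure (estimate t b a bs) {q. h + e < \<bar>Q t b a - q\<bar>} \<le> of_nat Nb * p"
proof -
  let ?P = "\<Pi>\<^sub>M i\<in>{1..Nb}. V' (Suc t) (bs i)"
  let ?f = "\<lambda>vs. \<rho> b a + \<gamma> / real Nb * (\<Sum>i = 1..Nb. vs i)"
  let ?B = "{q. h + e < \<bar>Q t b a - q\<bar>}"
  let ?C = "\<lambda>i. {v. e < \<bar>V (Suc t) (bs i) - v\<bar>}"
  have bsi: "bs i \<in> space S" if "i \<in> {1..Nb}" for i
    using bs that by (auto simp: space_PiM)
  have V': "sets (V' (Suc t) (bs i)) = sets borel" "prob_space (V' (Suc t) (bs i))" if "i \<in> {1..Nb}" for i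
    using V_est_in_prob_algebra[OF bsi[OF that]] by (auto simp: space_prob_algebra)
  interpret P: prob_space ?P by (intro prob_space_PiM V')
  have sets_P: "sets ?P = sets (\<Pi>\<^sub>M i\<in>{1..Nb}. borel)" by (intro sets_PiM_cong V' refl)
  have f [measurable]: "?f \<in> borel_measurable ?P"
    unfolding measurable_cong_sets[OF sets_P refl] by measurable
  have proj: "(\<lambda>vs. vs i) \<in> ?P \<rightarrow>\<^sub>M V' (Suc t) (bs i)" if "i \<in> {1..Nb}" for i
    using that by (rule measurable_component_singleton)
  have C: "?C i \<in> sets (V' (Suc t) (bs i))" if "i \<in> {1..Nb}" for i
    using V'(1)[OF that] by simp
  have bad: "\<exists>i\<in>{1..Nb}. vs i \<in> ?C i" if "?f vs \<in> ?B" for vs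
  proof (rule ccontr)
    assume "\<not> ?thesis"
    then have vs: "\<bar>V (Suc t) (bs i) - vs i\<bar> \<le> e" if "i \<in> {1..Nb}" for i using that by force
    let ?E = "\<integral>x. V (Suc t) x \<partial>\<tau> b a" and ?v = "(\<Sum>i = 1..Nb. vs i) / real Nb"
      and ?m = "(\<Sum>i = 1..Nb. V (Suc t) (bs i)) / real Nb"
    have "\<bar>\<Sum>i = 1..Nb. V (Suc t) (bs i) - vs i\<bar> \<le> (\<Sum>i = 1..Nb. \<bar>V (Suc t) (bs i) - vs i\<bar>)"
      by (rule sum_abs)
    also have "\<dots> \<le> real Nb * e" using sum_mono[OF vs, of "{1..Nb}"] by simp
    finally have "\<bar>?m - ?v\<bar> \<le> e"
      using Nb_pos by (simp add: sum_subtractf field_simps flip: diff_divide_distrib)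
    with dev have le: "\<bar>?E - ?v\<bar> \<le> h + e" by linarith
    \<comment> \<open>The immediate cost is known exactly and cancels; the remaining factor \<gamma>
      is then bounded by 1.\<close>
    have "\<bar>Q t b a - ?f vs\<bar> = \<gamma> * \<bar>?E - ?v\<bar>"
    proof -
      have "Q t b a - ?f vs = \<gamma> * (?E - ?v)" by (simp add: Q_val.simps algebra_simps)
      then show ?thesis using discount by (simp add: abs_mult)
    qed
    also have "\<dots> \<le> \<bar>?E - ?v\<bar>" using discount by (simp add: mult_left_le_one_le)
    finally show False using that le by simp
  qed
  have "?P \<bind> (\<lambda>vs. return borel (?f vs)) = distr ?P borel ?f"
    by (rule bind_return_distr'[OF P.not_empty f])
  then have "emeasure (?P \<bind> (\<lambda>vs. return borel (?f vs))) ?B = emeasure (distr ?P borel ?f) ?B"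
    by (rule arg_cong)
  also have "\<dots> = emeasure ?P (?f -` ?B \<inter> space ?P)" by (rule emeasure_distr[OF f]) simp
  also have "\<dots> \<le> emeasure ?P (\<Union>i\<in>{1..Nb}. (\<lambda>vs. vs i) -` ?C i \<inter> space ?P)"
    using bad by (intro emeasure_mono sets.finite_UN measurable_sets[OF proj] C) auto
  also have "\<dots> \<le> (\<Sum>i = 1..Nb. emeasure ?P ((\<lambda>vs. vs i) -` ?C i \<inter> space ?P))"
  proof (intro emeasure_subadditive_finite)
    show "(\<lambda>i. (\<lambda>vs. vs i) -` ?C i \<inter> space ?P) ` {1..Nb} \<subseteq> sets ?P"
      using measurable_sets[OF proj C] by blast
  qed simp
  \<comment> \<open>The i-th marginal of the product is the law of the estimator at the i-th
    successor, to which \<open>IH\<close> applies.\<close>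
  also have "\<dots> = (\<Sum>i = 1..Nb. emeasure (distr ?P (V' (Suc t) (bs i)) (\<lambda>vs. vs i)) (?C i))"
    by (intro sum.cong refl emeasure_distr[symmetric] proj C)
  also have "\<dots> = (\<Sum>i = 1..Nb. emeasure (V' (Suc t) (bs i)) (?C i))"
    by (intro sum.cong refl arg_cong2[where f = emeasure] distr_PiM_component V')
  also have "\<dots> \<le> (\<Sum>i = 1..Nb. p)" by (intro sum_mono IH bsi)
  finally show ?thesis by simp
qed

lemma kernel_PiM:
  assumes "b \<in> space S" "a \<in> space A"
  shows "(\<Pi>\<^sub>M i\<in>{1..Nb}. \<tau> b a) \<in> space (prob_algebra (\<Pi>\<^sub>M i\<in>{1..Nb}. S))"
  using kernel[OF assms] by (auto simp: space_prob_algebra intro!: prob_space_PiM sets_PiM_cong)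

lemma estimate_measurable_successors:
  assumes "b \<in> space S" "a \<in> space A"
  shows "estimate t b a \<in> (\<Pi>\<^sub>M i\<in>{1..Nb}. S) \<rightarrow>\<^sub>M prob_algebra borel"
proof -
  have "(b, a) \<in> space (S \<Otimes>\<^sub>M A)" using assms by (simp add: space_pair_measure)
  from measurable_compose[OF measurable_Pair1'[OF this] estimate_measurable[OF V_est_measurable]]
  show ?thesis by simp
qed

lemma emeasure_Q_est:
  assumes "b \<in> space S" "a \<in> space A" "B \<in> sets borel"
  shows "emeasure (Q' t b a) B = (\<integral>\<^sup>+bs. emeasure (estimate t b a bs) B \<partial>(\<Pi>\<^sub>M i\<in>{1..Nb}. \<tau> b a))"
  unfolding Q_est.simps
  by (rule emeasure_bind_prob_algebra[OF kernel_PiM estimate_measurable_successors]) fact+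

text \<open>Integrate the conditional failure probability over the successors. On the Hoeffding
  event \<open>?H\<close> it is bounded by 1, elsewhere by \<open>estimate_deviation\<close>; the
  probability of \<open>?H\<close> itself is the first summand.\<close>

lemma Q_est_deviation_step:
  assumes t: "t < T" and b: "b \<in> space S" and a: "a \<in> space A"
    and \<epsilon>: "0 \<le> \<epsilon>"
    and IH: "\<And>b. b \<in> space S \<Longrightarrow> emeasure (V' (Suc t) b) {v. e < \<bar>V (Suc t) b - v\<bar>} \<le> p"
  shows "emeasure (Q' t b a) {q. (hi - lo) * real (T - t) * \<epsilon> + e < \<bar>Q t b a - q\<bar>}
    \<le> ennreal (2 * exp (- 2 * real Nb * \<epsilon>\<^sup>2)) + of_nat Nb * p"
proof -
  let ?P = "\<Pi>\<^sub>M i\<in>{1..Nb}. \<tau> b a" and ?g = "discount_sum (Suc t)"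
  let ?h = "(hi - lo) * real (T - t) * \<epsilon>"
  let ?B = "{q. ?h + e < \<bar>Q t b a - q\<bar>}"
  let ?d = "\<lambda>bs. \<bar>(\<Sum>i = 1..Nb. V (Suc t) (bs i)) / real Nb - (\<integral>x. V (Suc t) x \<partial>\<tau> b a)\<bar>"
  let ?H = "{bs \<in> space ?P. (?g * hi - ?g * lo) * \<epsilon> < ?d bs}"
  from kernel[OF b a] have sets: "sets (\<tau> b a) = sets S" and prob: "prob_space (\<tau> b a)"
    by (auto simp: space_prob_algebra)
  note space = sets_eq_imp_space_eq[OF sets]
  interpret P: prob_space ?P by (intro prob_space_PiM prob)
  have sets_P: "sets ?P = sets (\<Pi>\<^sub>M i\<in>{1..Nb}. S)" by (intro sets_PiM_cong sets refl)
  have V [measurable]: "V (Suc t) \<in> borel_measurable (\<tau> b a)"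
    unfolding measurable_cong_sets[OF sets refl] by (rule V_measurable)
  have "lo \<le> hi" using cost_bounds[OF b a] by simp
  \<comment> \<open>Hoeffding's inequality is scaled by the range of \<open>V (Suc t)\<close>, of
    length \<open>(hi - lo) * ?g\<close>. Here \<open>?g\<close> sums \<open>T - t\<close> powers of
    \<gamma>, each at most 1.\<close>
  have "(?g * hi - ?g * lo) * \<epsilon> = (hi - lo) * ?g * \<epsilon>" by (simp add: algebra_simps)
  also have "\<dots> \<le> ?h"
    using discount_sum_le[of "Suc t"] \<open>lo \<le> hi\<close> \<epsilon>
    by (intro mult_right_mono mult_left_mono) auto
  finally have h: "(?g * hi - ?g * lo) * \<epsilon> \<le> ?h" .
  have H: "?H \<in> sets ?P" by measurable
  have "emeasure (Q' t b a) ?B = (\<integral>\<^sup>+bs. emeasure (estimate t b a bs) ?B \<partial>?P)"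
    by (rule emeasure_Q_est[OF b a]) simp
  also have "\<dots> \<le> (\<integral>\<^sup>+bs. indicator ?H bs + of_nat Nb * p \<partial>?P)"
  proof (rule nn_integral_mono)
    fix bs assume bs: "bs \<in> space ?P"
    then have bs': "bs \<in> space (\<Pi>\<^sub>M i\<in>{1..Nb}. S)" using sets_eq_imp_space_eq[OF sets_P] by simp
    show "emeasure (estimate t b a bs) ?B \<le> indicator ?H bs + of_nat Nb * p"
    proof (cases "bs \<in> ?H")
      case True
      have "prob_space (estimate t b a bs)" using measurable_space[OF estimate_measurable_successors[OF b a] bs'] by (simp add: space_prob_algebra)
      then have "emeasure (estimate t b a bs) ?B \<le> 1" by (intro subprob_space.subprob_emeasure_le_1 prob_space_imp_subprob_space)
      with True show ?thesis by (simp add: add_increasing2)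
    next
      case False
      with bs h have "?d bs \<le> ?h" by auto
      from estimate_deviation[OF b a bs' this IH] False show ?thesis by simp
    qed
  qed
  also have "\<dots> = emeasure ?P ?H + of_nat Nb * p"
  proof (subst nn_integral_add)
    show "(\<integral>\<^sup>+bs. indicator ?H bs \<partial>?P) + (\<integral>\<^sup>+bs. of_nat Nb * p \<partial>?P) = emeasure ?P ?H + of_nat Nb * p"
      by (simp only: nn_integral_const P.emeasure_space_1 mult_1_right nn_integral_indicator[OF H])
  qed (use H in auto)
  also have "emeasure ?P ?H \<le> ennreal (2 * exp (- 2 * real Nb * \<epsilon>\<^sup>2))"
  proof -
    have "P.prob ?H \<le> 2 * exp (- 2 * real (card {1..Nb}) * \<epsilon>\<^sup>2)"
      using Hoeffding_iid_PiM[OF prob V, where lo = "?g * lo" and hi = "?g * hi"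
          and I = "{1..Nb}" and \<epsilon> = \<epsilon>] V_bounds[of _ "Suc t"] \<epsilon> Nb_pos
      by (simp add: space)
    then show ?thesis
      unfolding P.emeasure_eq_measure card_atLeastAtMost diff_Suc_1 by (intro ennreal_leI) simp
  qed
  finally show ?thesis by (simp add: add_right_mono)
qed

text \<open>Iterating the one-step bound adds \<open>T - t\<close> to the radius factor at each
  level, giving the triangular number, and sends a node count \<open>M\<close> to
  \<open>1 + Nb * M\<close>, giving the geometric sum.\<close>

lemma Q_est_deviation:
  assumes \<epsilon>: "0 \<le> \<epsilon>" and t: "t \<le> T" and b: "b \<in> space S" and a: "a \<in> space A"
  shows "emeasure (Q' t b a)
      {q. (hi - lo) * (real (T - t) * real (T - t + 1) / 2) * \<epsilon> < \<bar>Q t b a - q\<bar>}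
    \<le> ennreal ((\<Sum>k < T - t. real Nb ^ k) * (2 * exp (- 2 * real Nb * \<epsilon>\<^sup>2)))"
  using t b a
proof (induction "T - t" arbitrary: t b a)
  case 0
  then have [simp]: "t = T" by simp
  \<comment> \<open>At the horizon all successor values and their estimates are 0, so the estimate
    is exact. The form \<open>0 + 0\<close> matches \<open>h + e\<close> in
    \<open>estimate_deviation\<close>.\<close>
  have "emeasure (Q' T b a) {q. 0 + 0 < \<bar>Q T b a - q\<bar>} =
      (\<integral>\<^sup>+bs. emeasure (estimate T b a bs) {q. 0 + 0 < \<bar>Q T b a - q\<bar>} \<partial>(\<Pi>\<^sub>M i\<in>{1..Nb}. \<tau> b a))"
    by (rule emeasure_Q_est[OF 0(3,4)]) simp
  also have "\<dots> \<le> (\<integral>\<^sup>+bs. of_nat Nb * 0 \<partial>(\<Pi>\<^sub>M i\<in>{1..Nb}. \<tau> b a))"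
  proof (intro nn_integral_mono estimate_deviation[OF 0(3,4)])
    have "sets (\<Pi>\<^sub>M i\<in>{1..Nb}. \<tau> b a) = sets (\<Pi>\<^sub>M i\<in>{1..Nb}. S)"
      using kernel_PiM[OF 0(3,4)] by (simp add: space_prob_algebra)
    then show "bs \<in> space (\<Pi>\<^sub>M i\<in>{1..Nb}. S)" if "bs \<in> space (\<Pi>\<^sub>M i\<in>{1..Nb}. \<tau> b a)" for bs
      using that sets_eq_imp_space_eq by blast
  qed (simp_all add: V_val.simps V_est.simps)
  finally show ?case by simp
next
  case (Suc n)
  let ?p = "2 * exp (- 2 * real Nb * \<epsilon>\<^sup>2)"
  let ?M = "\<lambda>n. \<Sum>k < n. real Nb ^ k"
  from Suc have t: "t < T" and n: "n = T - Suc t" and nT: "T - t = Suc n" by auto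
  have "emeasure (Q' t b a) {q. (hi - lo) * real (T - t) * \<epsilon> +
      (hi - lo) * (real (T - Suc t) * real (T - Suc t + 1) / 2) * \<epsilon> < \<bar>Q t b a - q\<bar>}
    \<le> ennreal ?p + of_nat Nb * ennreal (?M (T - Suc t) * ?p)"
  proof (rule Q_est_deviation_step[OF t Suc(4,5) \<epsilon>])
    fix b assume "b \<in> space S"
    then show "emeasure (V' (Suc t) b)
        {v. (hi - lo) * (real (T - Suc t) * real (T - Suc t + 1) / 2) * \<epsilon> < \<bar>V (Suc t) b - v\<bar>}
      \<le> ennreal (?M (T - Suc t) * ?p)"
      using Suc(1)[OF n, of b "\<pi> (Suc t) b"] t
      by (simp add: V_est.simps V_val.simps policy_in_space)
  qed
  also have "(hi - lo) * real (T - t) * \<epsilon> +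
      (hi - lo) * (real (T - Suc t) * real (T - Suc t + 1) / 2) * \<epsilon> =
      (hi - lo) * (real (T - t) * real (T - t + 1) / 2) * \<epsilon>"
    unfolding nT n[symmetric] by (simp add: field_simps)
  also have "ennreal ?p + of_nat Nb * ennreal (?M (T - Suc t) * ?p) = ennreal (?p + real Nb * (?M n * ?p))"
    unfolding n[symmetric]
    by (subst ennreal_plus) (auto simp: ennreal_mult ennreal_of_nat_eq_real_of_nat sum_nonneg)
  also have "?p + real Nb * (?M n * ?p) = ?M (T - t) * ?p"
    unfolding nT sum.lessThan_Suc_shift by (simp add: sum_distrib_left algebra_simps)
  finally show ?case .
qed

end

section \<open>Choice of \<epsilon> and the final probability bound\<close>

theorem theorem4p1:
  fixes X :: "'x measure" and A :: "'a measure"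
    and c :: "'x \<Rightarrow> 'a \<Rightarrow> real" and c_min c_max :: real
    and Np Nb T t :: nat
    and \<tau> :: "'x belief \<Rightarrow> 'a \<Rightarrow> 'x belief measure"
    and \<pi> :: "nat \<Rightarrow> 'x belief \<Rightarrow> 'a"
    and \<alpha> \<gamma> \<delta> :: real
    and b :: "'x belief" and a :: 'a
  assumes "(\<lambda>(x, a). c x a) \<in> borel_measurable (X \<Otimes>\<^sub>M A)"
    and "\<And>x a. x \<in> space X \<Longrightarrow> a \<in> space A \<Longrightarrow> c_min \<le> c x a \<and> c x a \<le> c_max"
    and "(\<lambda>(b, a). \<tau> b a)
           \<in> belief_space X Np \<Otimes>\<^sub>M A \<rightarrow>\<^sub>M prob_algebra (belief_space X Np)"
    and "\<And>s. s \<le> T \<Longrightarrow> \<pi> s \<in> belief_space X Np \<rightarrow>\<^sub>M A"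
    and "0 < \<alpha>" "\<alpha> \<le> 1" and "0 < \<gamma>" "\<gamma> \<le> 1"
    and "t \<le> T" and "b \<in> space (belief_space X Np)" and "a \<in> space A"
    and "0 < \<delta>" "\<delta> < 1" and "1 < Nb"
  shows "\<P>(q in Q_est (cvar_cost c Np \<alpha>) \<tau> \<gamma> T Nb \<pi> t b a.
           \<bar>Q_val (cvar_cost c Np \<alpha>) \<tau> \<gamma> T \<pi> t b a - q\<bar>
             \<le> (if t = T then 0
                else (c_max - c_min) * (real (T - t) * real (T - t + 1) / 2) *
                  sqrt (ln (2 * (real Nb ^ (T - t) - 1) / (\<delta> * (real Nb - 1)))
                        / (2 * real Nb))))
         \<ge> 1 - \<delta>"
proof -
  let ?S = "belief_space X Np" and ?\<rho> = "cvar_cost c Np \<alpha>"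
  let ?M = "\<Sum>k < T - t. real Nb ^ k"
  let ?\<epsilon> = "sqrt (ln (2 * (real Nb ^ (T - t) - 1) / (\<delta> * (real Nb - 1))) / (2 * real Nb))"
  let ?q = "Q_val ?\<rho> \<tau> \<gamma> T \<pi> t b a" and ?E = "Q_est ?\<rho> \<tau> \<gamma> T Nb \<pi> t b a"
  let ?r = "(c_max - c_min) * (real (T - t) * real (T - t + 1) / 2) * ?\<epsilon>"
  interpret bounded_cost_mdp ?S A ?\<rho> \<tau> \<gamma> c_min c_max T Nb \<pi>
  proof
    show "(\<lambda>(b, a). cvar_cost c Np \<alpha> b a) \<in> borel_measurable (?S \<Otimes>\<^sub>M A)"
      by (intro measurable_cvar_cost assms)
    show "cvar_cost c Np \<alpha> b a \<in> {c_min..c_max}" if "b \<in> space ?S" "a \<in> space A" for b a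
      using assms(2) that by (intro cvar_cost_bounds[OF assms(5,6)]) auto
  qed (use assms in auto)
  have M: "?M = (real Nb ^ (T - t) - 1) / (real Nb - 1)"
    using \<open>1 < Nb\<close> by (simp add: sum_gp_strict field_simps)
  have \<epsilon>: "0 \<le> ?\<epsilon> \<and> ?M * (2 * exp (- 2 * real Nb * ?\<epsilon>\<^sup>2)) \<le> \<delta>"
  \<comment> \<open>For \<open>t = T\<close> the argument of the logarithm is 0, and the convention
    \<open>ln 0 = 0\<close> makes \<open>?\<epsilon>\<close> equal to 0; the geometric sum is
    empty.\<close>
  proof (cases "t = T")
    case True
    then show ?thesis using \<open>0 < \<delta>\<close> by simp
  next
    case False
    \<comment> \<open>The term for \<open>k = 0\<close> gives \<open>?M \<ge> 1\<close>. Hence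
      \<open>2 * ?M / \<delta>\<close> is at least 1, its logarithm is nonnegative, and squaring
      undoes the square root.\<close>
    with \<open>t \<le> T\<close> have "{0} \<subseteq> {..<T - t}" by auto
    then have "(\<Sum>k\<in>{0}. real Nb ^ k) \<le> ?M" by (intro sum_mono2) auto
    then have M1: "1 \<le> ?M" by simp
    have arg: "2 * (real Nb ^ (T - t) - 1) / (\<delta> * (real Nb - 1)) = 2 * ?M / \<delta>"
      unfolding M by (simp add: field_simps)
    have ge: "1 \<le> 2 * ?M / \<delta>" using M1 \<open>0 < \<delta>\<close> \<open>\<delta> < 1\<close> by (simp add: field_simps)
    then have "0 \<le> ln (2 * ?M / \<delta>) / (2 * real Nb)" by simp
    then have nn: "0 \<le> ?\<epsilon>" and "?\<epsilon>\<^sup>2 = ln (2 * ?M / \<delta>) / (2 * real Nb)"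
      unfolding arg by simp_all
    then have "- 2 * real Nb * ?\<epsilon>\<^sup>2 = - ln (2 * ?M / \<delta>)" using \<open>1 < Nb\<close> by simp
    \<comment> \<open>Each of the \<open>?M\<close> nodes fails with probability at most
      \<open>2 * exp (- 2 * real Nb * ?\<epsilon>\<^sup>2)\<close>, which is now
      \<open>\<delta> / ?M\<close>.\<close>
    then have "exp (- 2 * real Nb * ?\<epsilon>\<^sup>2) = inverse (2 * ?M / \<delta>)"
      using ge by (simp add: exp_minus)
    with nn M1 show ?thesis by simp
  qed
  have E: "sets ?E = sets borel" "prob_space ?E"
    using Q_est_in_prob_algebra[OF assms(10,11)] by (auto simp: space_prob_algebra)
  interpret E: prob_space ?E by fact
  have space: "space ?E = UNIV" using sets_eq_imp_space_eq[OF E(1)] by simp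
  have "emeasure ?E {q. ?r < \<bar>?q - q\<bar>} \<le> ennreal (?M * (2 * exp (- 2 * real Nb * ?\<epsilon>\<^sup>2)))"
    using \<epsilon> assms by (intro Q_est_deviation) auto
  also have "\<dots> \<le> ennreal \<delta>" using \<epsilon> by (intro ennreal_leI) auto
  finally have "E.prob {q. ?r < \<bar>?q - q\<bar>} \<le> \<delta>"
    using \<open>0 < \<delta>\<close> by (simp add: E.emeasure_eq_measure)
  moreover have "E.prob {q \<in> space ?E. \<not> ?r < \<bar>?q - q\<bar>} = 1 - E.prob {q \<in> space ?E. ?r < \<bar>?q - q\<bar>}"
    by (rule E.prob_neg) (simp add: E(1) space)
  ultimately have prob: "1 - \<delta> \<le> E.prob {q \<in> space ?E. \<bar>?q - q\<bar> \<le> ?r}"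
    by (simp add: space not_less)
  \<comment> \<open>For \<open>t = T\<close> the factor \<open>real (T - t)\<close> already makes
    \<open>?r\<close> vanish, so the case distinction disappears.\<close>
  have r: "(if t = T then 0 else ?r) = ?r" by simp
  show ?thesis unfolding r by (rule prob)
qed

end
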